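(* Let $A$ be a simplicial line arrangement in the real projective plane, and let $C_A$ be the graph corresponding to $A$, i.e. the dual graph of the central plane arrangement $\hat A$ in $\mathbb{R}^3$ obtained by lifting $A$. Then $C_A$ is a cubic partial cube, and the number of vertices of $C_A$ is twice the number of triangles (cells) of $A$.
   Context: A line arrangement is a finite set of lines in the real projective plane; its cells are the connected components of the complement of the union of its lines. It is simplicial if each of its cells (including the cells meeting or passing through the line at infinity) is a triangle, i.e. is bounded by three sides belonging to three lines of the arrangement. Construction of $C_A$: embed the affine part of the projective plane as the plane $z=1$ in $\mathbb{R}^3$. Let $\hat A$ be the finite set of planes in $\mathbb{R}^3$ consisting of, for each finite line $\ell$ of $A$, the plane through $\ell$ and the origin, together with the plane $z=0$ if $A$ contains the line at infinity. (Equivalently, identifying points of the projective plane with lines through the origin of $\mathbb{R}^3$, each line of $A$ is replaced by the corresponding plane through the origin.) The graph $C_A$ has one vertex for each $3$-dimensional cell of $\hat A$ (connected component of the complement of the union of the planes), and two vertices are connected by an edge whenever the corresponding two cells meet along a $2$-dimensional face of the arrangement $\hat A$. A partial cube is an undirected graph whose vertices can be labeled by binary vectors (of a common length) in such a way that the graph distance between any two vertices equals the Hamming distance between their labels. A graph is cubic if every vertex has degree exactly three. *)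

theory Defs
  imports
    "HOL-Analysis.Analysis"
    "Graph_Theory.Pair_Digraph"
    "Graph_Theory.Shortest_Path"
begin

section \<open>The real projective plane\<close>

typedef proj_plane = "{L :: (real^3) set. subspace L \<and> dim L = 1}"
  morphisms origin_line Abs_proj_plane
proof -
  have "dim (span {axis 1 1 :: real^3}) = 1"
    by (simp add: dim_eq_card_independent axis_eq_0_iff)
  then show ?thesis
    using subspace_span by blast
qed

text \<open>Only meaningful for nonzero vectors.\<close>

definition proj_point :: "real^3 \<Rightarrow> proj_plane" where
  "proj_point v = Abs_proj_plane (span {v})"

text \<open>The quotient topology with respect to \<^const>\<open>proj_point\<close> on the nonzero vectors.\<close>

instantiation proj_plane :: topological_space
begin

definition open_proj_plane :: "proj_plane set \<Rightarrow> bool" where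
  "open_proj_plane U \<longleftrightarrow> open {v. v \<noteq> 0 \<and> proj_point v \<in> U}"

instance
proof
  have "{v :: real^3. v \<noteq> 0} = - {0}"
    by auto
  then show "open (UNIV :: proj_plane set)"
    by (simp add: open_proj_plane_def open_Compl)
next
  fix S T :: "proj_plane set"
  assume "open S" "open T"
  moreover have "{v. v \<noteq> 0 \<and> proj_point v \<in> S \<inter> T} =
      {v. v \<noteq> 0 \<and> proj_point v \<in> S} \<inter> {v. v \<noteq> 0 \<and> proj_point v \<in> T}"
    by auto
  ultimately show "open (S \<inter> T)"
    by (simp add: open_proj_plane_def open_Int)
next
  fix K :: "proj_plane set set"
  assume K: "\<forall>S\<in>K. open S"
  have "{v. v \<noteq> 0 \<and> proj_point v \<in> \<Union>K} = (\<Union>S\<in>K. {v. v \<noteq> 0 \<and> proj_point v \<in> S})"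
    by auto
  moreover have "open (\<Union>S\<in>K. {v. v \<noteq> 0 \<and> proj_point v \<in> S})"
    using K by (intro open_UN) (simp add: open_proj_plane_def)
  ultimately show "open (\<Union>K)"
    by (simp add: open_proj_plane_def)
qed

end

definition proj_line :: "proj_plane set \<Rightarrow> bool" where
  "proj_line l \<longleftrightarrow> (\<exists>P. subspace P \<and> dim P = 2 \<and> l = {p. origin_line p \<subseteq> P})"


section \<open>Arrangements\<close>

definition line_arrangement :: "proj_plane set set \<Rightarrow> bool" where
  "line_arrangement A \<longleftrightarrow> finite A \<and> (\<forall>l\<in>A. proj_line l)"

text \<open>The next two notions are used both for line arrangements in the projective plane and
  for plane arrangements in space. The codimension-one faces are relatively open: they are
  the edges of a line arrangement, respectively the two-dimensional faces of a plane
  arrangement.\<close>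

definition cells :: "'a::topological_space set set \<Rightarrow> 'a set set" where
  "cells A = components (- \<Union>A)"

definition facets :: "'a::topological_space set set \<Rightarrow> 'a set set" where
  "facets A = (\<Union>h\<in>A. components (h - \<Union>(A - {h})))"

definition sides :: "'a::topological_space set set \<Rightarrow> 'a set \<Rightarrow> 'a set set" where
  "sides A c = {s \<in> facets A. s \<subseteq> frontier c}"

definition triangle_in :: "proj_plane set set \<Rightarrow> proj_plane set \<Rightarrow> bool" where
  "triangle_in A c \<longleftrightarrow>
     card (sides A c) = 3 \<and> card {l \<in> A. \<exists>s\<in>sides A c. s \<subseteq> l} = 3"

definition simplicial :: "proj_plane set set \<Rightarrow> bool" where
  "simplicial A \<longleftrightarrow> line_arrangement A \<and> (\<forall>c\<in>cells A. triangle_in A c)"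


section \<open>The dual graph of the lifted arrangement\<close>

text \<open>The plane through the origin that corresponds to a projective line, as the union of the
  lines through the origin that are its points. The line at infinity is the one lifting to
  the plane \<open>z = 0\<close>.\<close>

definition lift_line :: "proj_plane set \<Rightarrow> (real^3) set" where
  "lift_line l = (\<Union>p\<in>l. origin_line p)"

definition lift_arrangement :: "proj_plane set set \<Rightarrow> (real^3) set set" where
  "lift_arrangement A = lift_line ` A"

definition dual_graph :: "'a::topological_space set set \<Rightarrow> 'a set pair_pre_digraph" where
  "dual_graph H = \<lparr> pverts = cells H,
     parcs = {(c, d). c \<in> cells H \<and> d \<in> cells H \<and> c \<noteq> d \<and> sides H c \<inter> sides H d \<noteq> {}} \<rparr>"

definition arrangement_graph :: "proj_plane set set \<Rightarrow> (real^3) set pair_pre_digraph" where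
  "arrangement_graph A = dual_graph (lift_arrangement A)"


section \<open>Cubic graphs and partial cubes\<close>

text \<open>Undirected graphs are symmetric loop-free digraphs; \<^const>\<open>pair_graph\<close> includes
  finiteness.\<close>

definition cubic :: "'v pair_pre_digraph \<Rightarrow> bool" where
  "cubic G \<longleftrightarrow> pair_graph G \<and> (\<forall>v\<in>pverts G. out_degree (with_proj G) v = 3)"

definition hamming :: "bool list \<Rightarrow> bool list \<Rightarrow> nat" where
  "hamming xs ys = card {i. i < length xs \<and> xs ! i \<noteq> ys ! i}"

text \<open>With unit arc costs, \<^const>\<open>wf_digraph.\<mu>\<close> is the graph distance
  (infinite between different connected components). Finiteness of the graph is no
  restriction here: distinct vertices have distinct labels of the common length \<open>n\<close>.\<close>

definition partial_cube :: "'v pair_pre_digraph \<Rightarrow> bool" where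
  "partial_cube G \<longleftrightarrow> pair_graph G \<and>
     (\<exists>n (label :: 'v \<Rightarrow> bool list).
        (\<forall>v\<in>pverts G. length (label v) = n) \<and>
        (\<forall>u\<in>pverts G. \<forall>v\<in>pverts G.
           wf_digraph.\<mu> (with_proj G) (\<lambda>_. 1) u v = ereal (real (hamming (label u) (label v)))))"

end

theory Submission
  imports Defs
begin

text \<open>
  Choose a normal vector for every lifted plane and record, for each point of space, on which
  side of every plane it lies. The points with a given sign vector form a convex set, and the
  cells and facets of the plane arrangement turn out to be exactly the nonempty sets of this
  kind with no zero sign, respectively with exactly one zero sign. All incidences become
  combinatorics of sign vectors: a facet bounds a cell iff its vector arises from that of the
  cell by replacing one sign by zero, and crossing the facet reverses this sign. The neighbours
  of a cell thus correspond to its sides, one for each of its walls.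

  Labelling a cell with its sign vector gives the partial cube. An arc changes one sign, so the
  distance of two cells is at least the number of planes that separate them. Conversely, a
  segment between generic points of two distinct cells crosses the separating planes one at a
  time; the first one crossed is a wall of the first cell, and stepping through it lowers the
  number of separating planes (lemma \<open>exists_separating_wall\<close>). So this number is attained.

  The projection to the projective plane is continuous, open, and identifies a sign vector with
  its negative and with nothing else. Hence the cells and edges of the line arrangement are the
  projected cells and facets (\<open>components_of_proj_stratum\<close>). A vector without zeros
  differs from its negative, so cells are identified in pairs, which gives the factor two.
  A cell has as many sides as its projection (\<open>card_proj_sides\<close>), because of two
  opposite facets at most one bounds a given cell. Since each projected cell is a triangle,
  every cell has three sides and therefore three neighbours.
\<close>

section \<open>Open partitions and graphs labelled by sets\<close>

text \<open>A class is also relatively closed, its complement being the union of the other classes,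
  so a connected set that meets a class lies inside it. Faces with a common zero set form such a
  partition, in space as well as in the projective plane.\<close>

lemma components_of_open_partition:
  fixes S :: "'a::topological_space set"
  assumes union: "\<Union>\<C> = S"
    and disj: "\<And>C D. C \<in> \<C> \<Longrightarrow> D \<in> \<C> \<Longrightarrow> C \<inter> D \<noteq> {} \<Longrightarrow> C = D"
    and conn: "\<And>C. C \<in> \<C> \<Longrightarrow> connected C"
    and nonempty: "\<And>C. C \<in> \<C> \<Longrightarrow> C \<noteq> {}"
    and opn: "\<And>C. C \<in> \<C> \<Longrightarrow> openin (top_of_set S) C"
  shows "components S = \<C>"
proof -
  have sub: "T \<subseteq> C" if CT: "C \<in> \<C>" "connected T" "T \<subseteq> S" "C \<inter> T \<noteq> {}" for C T
  proof -
    have "openin (top_of_set S) (\<Union>(\<C> - {C}))"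
      using opn by blast
    moreover have "S - C = \<Union>(\<C> - {C})"
      using union disj CT(1) by blast
    ultimately have "closedin (top_of_set S) C"
      using CT(1) union by (auto simp: closedin_def)
    then obtain K where "closed K" "C = S \<inter> K"
      by (auto simp: closedin_closed)
    moreover obtain U where "open U" "C = S \<inter> U"
      using opn[OF CT(1)] by (auto simp: openin_open)
    ultimately have "closedin (top_of_set T) (T \<inter> C)" "openin (top_of_set T) (T \<inter> C)"
      using CT(3) unfolding closedin_closed openin_open by blast+
    then show ?thesis
      using CT(2,4) unfolding connected_clopen by blast
  qed
  have component: "C \<in> components S" if C: "C \<in> \<C>" for C
    unfolding in_components_maximal
  proof (intro conjI allI impI)
    show "C \<noteq> {}" "C \<subseteq> S" "connected C"
      using C nonempty conn union by auto
    fix D assume D: "D \<noteq> {} \<and> C \<subseteq> D \<and> D \<subseteq> S \<and> connected D"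
    then have "D \<subseteq> C"
      using nonempty[OF C] by (intro sub[OF C]) auto
    then show "D = C" using D by blast
  qed
  show ?thesis
  proof (intro equalityI subsetI component)
    fix C assume C: "C \<in> components S"
    obtain x where x: "x \<in> C"
      using in_components_nonempty[OF C] by auto
    then have "x \<in> \<Union>\<C>"
      using in_components_subset[OF C] union by auto
    then obtain D where D: "D \<in> \<C>" "D \<inter> C \<noteq> {}"
      using x by auto
    then show "C \<in> \<C>"
      using components_eq[OF component[OF D(1)] C] by simp
  qed
qed

lemma hamming_membership_lists:
  assumes "distinct hs" "X \<subseteq> set hs" "Y \<subseteq> set hs"
  shows "hamming (map (\<lambda>h. h \<in> X) hs) (map (\<lambda>h. h \<in> Y) hs) = card (sym_diff X Y)"
proof -
  let ?I = "{i. i < length hs \<and> hs ! i \<in> sym_diff X Y}"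
  have "hamming (map (\<lambda>h. h \<in> X) hs) (map (\<lambda>h. h \<in> Y) hs) = card ?I"
    unfolding hamming_def by (rule arg_cong[of _ _ card]) (auto simp: nth_map)
  also have "inj_on ((!) hs) ?I"
    using assms(1) by (simp add: inj_on_def nth_eq_iff_index_eq)
  then have "card ?I = card ((!) hs ` ?I)"
    by (simp add: card_image)
  also have "(!) hs ` ?I = sym_diff X Y"
  proof (intro equalityI subsetI)
    fix h assume "h \<in> sym_diff X Y"
    then obtain i where "i < length hs" "hs ! i = h"
      using assms(2,3) by (metis DiffE UnE in_set_conv_nth subsetD)
    then show "h \<in> (!) hs ` ?I"
      using \<open>h \<in> sym_diff X Y\<close> by blast
  qed blast
  finally show ?thesis .
qed

text \<open>The label changes by one element along an arc, which bounds distances from below; the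
  last hypothesis allows a greedy walk that removes at least one differing element per step.\<close>

lemma partial_cube_of_set_labels:
  fixes G :: "'v pair_pre_digraph" and lab :: "'v \<Rightarrow> 'i set"
  assumes graph: "pair_graph G" and fin: "finite I"
    and lab: "\<And>v. v \<in> pverts G \<Longrightarrow> lab v \<subseteq> I"
    and arc: "\<And>u v. (u, v) \<in> parcs G \<Longrightarrow> card (sym_diff (lab u) (lab v)) = 1"
    and closer: "\<And>u v. u \<in> pverts G \<Longrightarrow> v \<in> pverts G \<Longrightarrow> u \<noteq> v \<Longrightarrow>
      \<exists>w. (u, w) \<in> parcs G \<and> card (sym_diff (lab w) (lab v)) < card (sym_diff (lab u) (lab v))"
  shows "partial_cube G"
proof -
  interpret pair_graph G by fact
  have lower: "card (sym_diff (lab u) (lab v)) \<le> length p" if "awalk u p v" for u p v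
    using that
  proof (induction p arbitrary: u)
    case Nil
    then show ?case by (simp add: awalk_Nil_iff)
  next
    case (Cons e p)
    then have e: "e \<in> parcs G" "fst e = u" and p: "awalk (snd e) p v"
      by (auto simp: awalk_Cons_iff)
    have vs: "v \<in> pverts G" "snd e \<in> pverts G" "u \<in> pverts G"
      using p e by (auto intro: wellformed)
    have fins: "finite (lab v)" "finite (lab u)" "finite (lab (snd e))"
      by (auto intro: finite_subset[OF lab fin] vs)
    have "card (sym_diff (lab u) (lab v))
        \<le> card (sym_diff (lab u) (lab (snd e)) \<union> sym_diff (lab (snd e)) (lab v))"
      using fins by (intro card_mono) auto
    also have "\<dots> \<le> card (sym_diff (lab u) (lab (snd e))) + card (sym_diff (lab (snd e)) (lab v))"
      by (rule card_Un_le)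
    also have "card (sym_diff (lab u) (lab (snd e))) = 1"
      using arc[of u "snd e"] e by (cases e) auto
    finally show ?case
      using Cons.IH[OF p] by simp
  qed
  have upper: "\<exists>p. awalk u p v \<and> length p \<le> card (sym_diff (lab u) (lab v))"
    if "u \<in> pverts G" "v \<in> pverts G" for u v
    using that
  proof (induction "card (sym_diff (lab u) (lab v))" arbitrary: u rule: less_induct)
    case less
    show ?case
    proof (cases "u = v")
      case True
      then show ?thesis
        using less.prems by (intro exI[of _ "[]"]) (simp add: awalk_Nil_iff)
    next
      case False
      then obtain w where w: "(u, w) \<in> parcs G"
        "card (sym_diff (lab w) (lab v)) < card (sym_diff (lab u) (lab v))"
        using closer less.prems by blast
      then have "w \<in> pverts G"
        using in_arcsD2 by blast
      then obtain p where "awalk w p v" "length p \<le> card (sym_diff (lab w) (lab v))"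
        using less.hyps[OF w(2)] less.prems by blast
      then have "awalk u ((u, w) # p) v" "length ((u, w) # p) \<le> card (sym_diff (lab u) (lab v))"
        using w less.prems by (auto simp: awalk_Cons_iff)
      then show ?thesis by blast
    qed
  qed
  have cost: "awalk_cost (\<lambda>_. 1) p = length p" for p
    by (induction p) auto
  have dist: "\<mu> (\<lambda>_. 1) u v = ereal (card (sym_diff (lab u) (lab v)))"
    if uv: "u \<in> pverts G" "v \<in> pverts G" for u v
  proof (rule antisym)
    obtain p where p: "awalk u p v" "length p \<le> card (sym_diff (lab u) (lab v))"
      using upper[OF uv] by blast
    have "\<mu> (\<lambda>_. 1) u v \<le> ereal (length p)"
      using min_cost_le_walk_cost[OF p(1), of "\<lambda>_. 1"] by (simp add: cost)
    also have "\<dots> \<le> ereal (card (sym_diff (lab u) (lab v)))"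
      using p(2) by simp
    finally show "\<mu> (\<lambda>_. 1) u v \<le> ereal (card (sym_diff (lab u) (lab v)))" .
    show "ereal (card (sym_diff (lab u) (lab v))) \<le> \<mu> (\<lambda>_. 1) u v"
      unfolding \<mu>_def using lower cost by (intro INF_greatest) simp
  qed
  obtain hs where hs: "set hs = I" "distinct hs"
    using fin finite_distinct_list by blast
  show ?thesis
    unfolding partial_cube_def
  proof (intro conjI graph exI[of _ "length hs"] exI[of _ "\<lambda>v. map (\<lambda>h. h \<in> lab v) hs"] ballI)
    fix u v assume uv: "u \<in> pverts G" "v \<in> pverts G"
    then show "\<mu> (\<lambda>_. 1) u v =
      ereal (real (hamming (map (\<lambda>h. h \<in> lab u) hs) (map (\<lambda>h. h \<in> lab v) hs)))"
      using dist[OF uv] hamming_membership_lists[OF hs(2)] lab[OF uv(1)] lab[OF uv(2)] hs(1) by simp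
  qed simp
qed

section \<open>Sign vectors of a central hyperplane arrangement\<close>

text \<open>Finitely many hyperplanes have measure zero and cannot cover a nonempty open set.\<close>

lemma exists_generic_point:
  fixes U N :: "'a::euclidean_space set"
  assumes "open U" "U \<noteq> {}" "finite N" "0 \<notin> N"
  shows "\<exists>x\<in>U. \<forall>a\<in>N. a \<bullet> x \<noteq> 0"
proof -
  have "negligible (\<Union>a\<in>N. {x. a \<bullet> x = 0})"
    using assms(3,4) by (intro negligible_Union) (auto intro!: negligible_hyperplane)
  then have "\<not> U \<subseteq> (\<Union>a\<in>N. {x. a \<bullet> x = 0})"
    using assms(1,2) open_not_negligible negligible_subset by blast
  then show ?thesis by blast
qed

text \<open>The normals serve only to distinguish the two sides of each hyperplane.\<close>

locale central_arrangement =
  fixes H :: "'a::euclidean_space set set" and normal :: "'a set \<Rightarrow> 'a"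
  assumes finite_H: "finite H"
    and normal_nonzero: "h \<in> H \<Longrightarrow> normal h \<noteq> 0"
    and hyperplane_eq: "h \<in> H \<Longrightarrow> h = {x. normal h \<bullet> x = 0}"
begin

text \<open>The value outside \<open>H\<close> is fixed so that equality of functions means equality of the
  signs with respect to \<open>H\<close>.\<close>

definition signs :: "'a \<Rightarrow> 'a set \<Rightarrow> real" where
  "signs x h = (if h \<in> H then sgn (normal h \<bullet> x) else 0)"

definition face :: "('a set \<Rightarrow> real) \<Rightarrow> 'a set" where
  "face \<rho> = {x. signs x = \<rho>}"

text \<open>In the language of oriented matroids, the covectors with a prescribed zero set. The topes
  describe the cells, the subtopes the facets.\<close>

definition covectors :: "'a set set \<Rightarrow> ('a set \<Rightarrow> real) set" where
  "covectors Z = {\<rho> \<in> range signs. \<forall>h\<in>H. \<rho> h = 0 \<longleftrightarrow> h \<in> Z}"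

abbreviation topes :: "('a set \<Rightarrow> real) set" where
  "topes \<equiv> covectors {}"

definition subtopes :: "('a set \<Rightarrow> real) set" where
  "subtopes = (\<Union>h\<in>H. covectors {h})"

text \<open>The union of all faces whose closure contains \<open>face \<rho>\<close>, an open neighbourhood of this
  face.\<close>

definition star :: "('a set \<Rightarrow> real) \<Rightarrow> 'a set" where
  "star \<rho> = {x. \<forall>h\<in>H. \<rho> h \<noteq> 0 \<longrightarrow> signs x h = \<rho> h}"

text \<open>The face order: for covectors it means that \<open>face \<tau>\<close> lies in the closure of
  \<open>face \<sigma>\<close>.\<close>

definition conforms :: "('a set \<Rightarrow> real) \<Rightarrow> ('a set \<Rightarrow> real) \<Rightarrow> bool" where
  "conforms \<tau> \<sigma> \<longleftrightarrow> (\<forall>h. \<tau> h \<noteq> 0 \<longrightarrow> \<sigma> h = \<tau> h)"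

text \<open>The hyperplanes that contain a facet of the cell.\<close>

definition walls :: "('a set \<Rightarrow> real) \<Rightarrow> 'a set set" where
  "walls \<sigma> = {h \<in> H. \<sigma>(h := 0) \<in> range signs}"

lemma signs_0: "signs 0 = (\<lambda>_. 0)"
  by (auto simp: signs_def fun_eq_iff)

lemma signs_outside: "h \<notin> H \<Longrightarrow> signs x h = 0"
  by (simp add: signs_def)

lemma signs_minus: "signs (- x) = - signs x"
  by (auto simp: signs_def fun_eq_iff sgn_minus)

lemma signs_scaleR: "0 < c \<Longrightarrow> signs (c *\<^sub>R x) = signs x"
  by (auto simp: signs_def fun_eq_iff sgn_mult)

lemma signs_eq_0_iff: "h \<in> H \<Longrightarrow> signs x h = 0 \<longleftrightarrow> x \<in> h"
  using hyperplane_eq[of h] by (auto simp: signs_def sgn_0_0)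

lemma covector_outside: "\<rho> \<in> range signs \<Longrightarrow> h \<notin> H \<Longrightarrow> \<rho> h = 0"
  by (auto simp: signs_def)

lemma covector_values: "\<rho> \<in> range signs \<Longrightarrow> \<rho> h = 0 \<or> \<rho> h = 1 \<or> \<rho> h = -1"
  by (auto simp: signs_def sgn_if split: if_splits)

lemma tope_covector: "\<sigma> \<in> topes \<Longrightarrow> \<sigma> \<in> range signs"
  by (simp add: covectors_def)

lemma tope_values: "\<sigma> \<in> topes \<Longrightarrow> h \<in> H \<Longrightarrow> \<sigma> h = 1 \<or> \<sigma> h = -1"
  using covector_values[of \<sigma> h] by (auto simp: covectors_def)

lemma minus_covectors: "\<rho> \<in> covectors Z \<Longrightarrow> - \<rho> \<in> covectors Z"
  unfolding covectors_def by (auto simp flip: signs_minus)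

lemma face_nonempty: "\<rho> \<in> range signs \<Longrightarrow> face \<rho> \<noteq> {}"
  by (auto simp: face_def)

lemma face_eq_iff:
  "\<rho> \<in> range signs \<Longrightarrow> \<rho>' \<in> range signs \<Longrightarrow> face \<rho> = face \<rho>' \<longleftrightarrow> \<rho> = \<rho>'"
  by (auto simp: face_def)

lemma inj_on_face: "inj_on face (range signs)"
  by (auto simp: inj_on_def face_eq_iff)

lemma finite_covectors: "finite (range signs)"
proof -
  have "finite {f. \<forall>h. (h \<in> H \<longrightarrow> f h \<in> {0, 1, -1 :: real}) \<and> (h \<notin> H \<longrightarrow> f h = 0)}"
    by (intro finite_set_of_finite_funs finite_H) simp
  then show ?thesis
    by (rule rev_finite_subset) (auto simp: signs_def sgn_if split: if_splits)
qed

lemma convex_sign_region: "convex {x. sgn (v \<bullet> x) = (s :: real)}"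
proof -
  consider "s = 0" | "s = 1" | "s = -1" | "\<forall>x. sgn (v \<bullet> x) \<noteq> s"
    by (metis sgn_if)
  then show ?thesis
  proof cases
    case 1
    then show ?thesis using convex_hyperplane[of v 0] by (simp add: sgn_0_0)
  next
    case 2
    then show ?thesis using convex_halfspace_gt[of 0 v] by (simp add: sgn_1_pos)
  next
    case 3
    then show ?thesis using convex_halfspace_lt[of v 0] by (simp add: sgn_1_neg)
  qed simp
qed

lemma convex_face: "\<rho> \<in> range signs \<Longrightarrow> convex (face \<rho>)"
proof -
  assume "\<rho> \<in> range signs"
  then have "face \<rho> = (\<Inter>h\<in>H. {x. sgn (normal h \<bullet> x) = \<rho> h})"
    by (auto simp: face_def signs_def fun_eq_iff)
  then show ?thesis
    by (auto intro!: convex_INT convex_sign_region)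
qed

lemma connected_face: "\<rho> \<in> range signs \<Longrightarrow> connected (face \<rho>)"
  by (simp add: convex_face convex_connected)

lemma open_star: "\<rho> \<in> range signs \<Longrightarrow> open (star \<rho>)"
proof -
  assume \<rho>: "\<rho> \<in> range signs"
  have "open {x. \<rho> h \<noteq> 0 \<longrightarrow> signs x h = \<rho> h}" if h: "h \<in> H" for h
  proof -
    consider "\<rho> h = 0" | "\<rho> h = 1" | "\<rho> h = -1"
      using covector_values[OF \<rho>] by blast
    then show ?thesis
    proof cases
      case 1
      then show ?thesis by simp
    next
      case 2
      then show ?thesis
        using h open_halfspace_gt[of 0 "normal h"] by (simp add: signs_def sgn_1_pos)
    next
      case 3
      then show ?thesis
        using h open_halfspace_lt[of "normal h" 0] by (simp add: signs_def sgn_1_neg)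
    qed
  qed
  moreover have "star \<rho> = (\<Inter>h\<in>H. {x. \<rho> h \<noteq> 0 \<longrightarrow> signs x h = \<rho> h})"
    by (auto simp: star_def)
  ultimately show ?thesis
    using finite_H by (simp add: open_INT)
qed

lemma face_subset_star: "face \<rho> \<subseteq> star \<rho>"
  by (auto simp: face_def star_def)

text \<open>Faces with the same zero set are separated by their stars, hence relatively open in their
  union.\<close>

lemma star_Int_covectors:
  assumes "\<rho> \<in> covectors Z" "x \<in> star \<rho>" "signs x \<in> covectors Z"
  shows "x \<in> face \<rho>"
proof -
  have "signs x h = \<rho> h" for h
  proof (cases "h \<in> H \<and> h \<notin> Z")
    case True
    then show ?thesis using assms by (auto simp: covectors_def star_def)
  next
    case False
    then show ?thesis
      using assms by (cases "h \<in> H") (auto simp: covectors_def signs_outside)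
  qed
  then show ?thesis by (auto simp: face_def)
qed

lemma face_tope_eq_star:
  assumes "\<sigma> \<in> topes"
  shows "face \<sigma> = star \<sigma>"
proof (intro equalityI subsetI)
  fix x assume "x \<in> star \<sigma>"
  moreover from this have "signs x \<in> topes"
    using assms by (simp add: covectors_def star_def)
  ultimately show "x \<in> face \<sigma>"
    using star_Int_covectors[OF assms] by simp
qed (use face_subset_star in auto)

lemma components_of_stratum:
  "components {x. signs x \<in> covectors Z} = face ` covectors Z"
proof (rule components_of_open_partition)
  fix C assume "C \<in> face ` covectors Z"
  then obtain \<rho> where \<rho>: "\<rho> \<in> covectors Z" "C = face \<rho>"
    by blast
  then have r: "\<rho> \<in> range signs"
    by (simp add: covectors_def)
  show "connected C" "C \<noteq> {}"
    using \<rho> r by (auto simp: connected_face face_nonempty)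
  have "C = {x. signs x \<in> covectors Z} \<inter> star \<rho>"
    using \<rho> face_subset_star star_Int_covectors by (auto simp: face_def)
  then show "openin (top_of_set {x. signs x \<in> covectors Z}) C"
    using open_star[OF r] by blast
qed (auto simp: face_def)

lemma cells_eq: "cells H = face ` topes"
proof -
  have "- \<Union>H = {x. signs x \<in> covectors {}}"
    using signs_eq_0_iff by (auto simp: covectors_def)
  then show ?thesis
    by (simp add: cells_def components_of_stratum)
qed

lemma facets_eq: "facets H = face ` subtopes"
proof -
  have "h - \<Union>(H - {h}) = {x. signs x \<in> covectors {h}}" if "h \<in> H" for h
    using that signs_eq_0_iff by (auto simp: covectors_def)
  then show ?thesis
    by (auto simp: facets_def subtopes_def components_of_stratum)
qed

text \<open>A small step away from \<open>z\<close> cannot change a nonzero sign, and on the hyperplanes through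
  \<open>z\<close> the direction alone decides. This realises the composition of covectors and is the
  tool for approaching a face and for crossing a wall.\<close>

lemma signs_perturb:
  "\<exists>\<delta>>0. \<forall>\<epsilon>. 0 < \<epsilon> \<and> \<epsilon> < \<delta> \<longrightarrow>
     signs (z + \<epsilon> *\<^sub>R v) = (\<lambda>h. if signs z h = 0 then signs v h else signs z h)"
proof -
  have "open ((\<lambda>\<epsilon>. z + \<epsilon> *\<^sub>R v) -` star (signs z))"
    by (intro open_vimage open_star continuous_intros) auto
  moreover have "0 \<in> (\<lambda>\<epsilon>. z + \<epsilon> *\<^sub>R v) -` star (signs z)"
    by (simp add: star_def)
  ultimately obtain \<delta> where \<delta>: "\<delta> > 0" "ball 0 \<delta> \<subseteq> (\<lambda>\<epsilon>. z + \<epsilon> *\<^sub>R v) -` star (signs z)"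
    using open_contains_ball by blast
  have "signs (z + \<epsilon> *\<^sub>R v) h = (if signs z h = 0 then signs v h else signs z h)"
    if e: "0 < \<epsilon>" "\<epsilon> < \<delta>" for \<epsilon> h
  proof (cases "h \<in> H \<and> signs z h \<noteq> 0")
    case True
    have "\<epsilon> \<in> ball 0 \<delta>"
      using e by (simp add: dist_real_def)
    then have "z + \<epsilon> *\<^sub>R v \<in> star (signs z)"
      using \<delta>(2) by auto
    then show ?thesis
      using True by (auto simp: star_def)
  next
    case False
    then show ?thesis
      using e by (auto simp: signs_def inner_add_right sgn_mult sgn_0_0)
  qed
  then show ?thesis
    using \<delta>(1) by blast
qed

text \<open>A limit point conforms because its star meets the face; conversely, a small step from a
  conforming point towards a point of the face ends in the face.\<close>

lemma closure_face:
  assumes "\<sigma> \<in> range signs"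
  shows "closure (face \<sigma>) = {z. conforms (signs z) \<sigma>}"
proof (intro equalityI subsetI)
  fix z assume "z \<in> closure (face \<sigma>)"
  moreover have "open (star (signs z))" "z \<in> star (signs z)"
    using open_star face_subset_star by (auto simp: face_def)
  ultimately obtain y where "y \<in> star (signs z)" "y \<in> face \<sigma>"
    by (meson closure_iff_nhds_not_empty disjoint_iff order_refl)
  then have "conforms (signs z) \<sigma>"
    by (auto simp: conforms_def star_def face_def signs_def)
  then show "z \<in> {z. conforms (signs z) \<sigma>}" by simp
next
  fix z assume "z \<in> {z. conforms (signs z) \<sigma>}"
  then have z: "conforms (signs z) \<sigma>" by simp
  obtain x where x: "\<sigma> = signs x" using assms by blast
  obtain \<delta> where \<delta>: "\<delta> > 0" "\<And>\<epsilon>. 0 < \<epsilon> \<Longrightarrow> \<epsilon> < \<delta> \<Longrightarrow> signs (z + \<epsilon> *\<^sub>R x) = \<sigma>"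
  proof -
    have "(\<lambda>h. if signs z h = 0 then signs x h else signs z h) = \<sigma>"
      using z x by (auto simp: conforms_def fun_eq_iff)
    then show ?thesis
      using signs_perturb[of z x] that by auto
  qed
  have "((\<lambda>\<epsilon>. z + \<epsilon> *\<^sub>R x) \<longlongrightarrow> z) (at_right 0)"
    by (auto intro!: tendsto_eq_intros)
  moreover have "\<forall>\<^sub>F \<epsilon> in at_right 0. z + \<epsilon> *\<^sub>R x \<in> closure (face \<sigma>)"
    unfolding eventually_at_right_field
  proof (intro exI[of _ \<delta>] conjI allI impI)
    fix \<epsilon> assume "0 < \<epsilon>" "\<epsilon> < \<delta>"
    then have "z + \<epsilon> *\<^sub>R x \<in> face \<sigma>"
      using \<delta>(2) by (simp add: face_def)
    then show "z + \<epsilon> *\<^sub>R x \<in> closure (face \<sigma>)"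
      using closure_subset by auto
  qed (fact \<delta>(1))
  ultimately show "z \<in> closure (face \<sigma>)"
    by (intro Lim_in_closed_set[of "closure (face \<sigma>)" "\<lambda>\<epsilon>. z + \<epsilon> *\<^sub>R x" "at_right 0"]) auto
qed

lemma subtope_not_tope: "\<tau> \<in> subtopes \<Longrightarrow> \<tau> \<notin> topes"
  by (auto simp: subtopes_def covectors_def)

lemma subtopes_subset: "subtopes \<subseteq> range signs"
  by (auto simp: subtopes_def covectors_def)

lemma topes_subset: "topes \<subseteq> range signs"
  by (auto simp: covectors_def)

lemma face_subset_frontier_iff:
  assumes "\<sigma> \<in> topes" "\<tau> \<in> subtopes"
  shows "face \<tau> \<subseteq> frontier (face \<sigma>) \<longleftrightarrow> conforms \<tau> \<sigma>"
proof -
  have s: "\<sigma> \<in> range signs" "\<tau> \<in> range signs"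
    using assms topes_subset subtopes_subset by auto
  have "open (face \<sigma>)"
    using assms s open_star by (simp add: face_tope_eq_star)
  then have "frontier (face \<sigma>) = {z. conforms (signs z) \<sigma>} - face \<sigma>"
    by (simp add: frontier_def closure_face s interior_open)
  moreover have "face \<tau> \<inter> face \<sigma> = {}"
    using assms subtope_not_tope by (auto simp: face_def)
  moreover have "face \<tau> \<subseteq> {z. conforms (signs z) \<sigma>} \<longleftrightarrow> conforms \<tau> \<sigma>"
    using s(2) by (auto simp: face_def)
  ultimately show ?thesis
    by blast
qed

lemma sides_eq:
  assumes "\<sigma> \<in> topes"
  shows "sides H (face \<sigma>) = face ` {\<tau> \<in> subtopes. conforms \<tau> \<sigma>}"
  unfolding sides_def facets_eq using face_subset_frontier_iff[OF assms] by blast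

text \<open>The subtopes that conform to a tope are its facets, so a facet is determined by the wall in
  which it lies.\<close>

lemma conforming_subtopes_eq:
  assumes "\<sigma> \<in> topes"
  shows "{\<tau> \<in> subtopes. conforms \<tau> \<sigma>} = (\<lambda>h. \<sigma>(h := 0)) ` walls \<sigma>"
proof (intro equalityI subsetI)
  fix \<tau> assume "\<tau> \<in> {\<tau> \<in> subtopes. conforms \<tau> \<sigma>}"
  then obtain h where h: "h \<in> H" "\<tau> \<in> covectors {h}" and c: "conforms \<tau> \<sigma>"
    by (auto simp: subtopes_def)
  have "\<tau> k = (\<sigma>(h := 0)) k" for k
  proof (cases "k \<in> H")
    case True
    then show ?thesis using h c by (auto simp: covectors_def conforms_def)
  next
    case False
    then show ?thesis using h assms by (auto simp: covectors_def covector_outside)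
  qed
  then have "\<tau> = \<sigma>(h := 0)" by blast
  then show "\<tau> \<in> (\<lambda>h. \<sigma>(h := 0)) ` walls \<sigma>"
    using h by (auto simp: walls_def covectors_def)
next
  fix \<tau> assume "\<tau> \<in> (\<lambda>h. \<sigma>(h := 0)) ` walls \<sigma>"
  then obtain h where "h \<in> H" "\<tau> = \<sigma>(h := 0)" "\<tau> \<in> range signs"
    by (auto simp: walls_def)
  then show "\<tau> \<in> {\<tau> \<in> subtopes. conforms \<tau> \<sigma>}"
    using assms by (auto simp: subtopes_def covectors_def conforms_def intro!: bexI[of _ h])
qed

text \<open>From a point of the facet in the wall, a small step along \<open>- x\<close>, where \<open>x\<close> is a point of
  the cell, leads to the other side of the wall and of no other hyperplane.\<close>

lemma reflection_in_wall:
  assumes "\<sigma> \<in> topes" "h \<in> walls \<sigma>"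
  shows "\<sigma>(h := - \<sigma> h) \<in> topes"
proof -
  obtain x z where x: "\<sigma> = signs x" and z: "\<sigma>(h := 0) = signs z" and h: "h \<in> H"
    using assms by (auto simp: walls_def covectors_def)
  have "(\<lambda>k. if signs z k = 0 then signs (- x) k else signs z k) = \<sigma>(h := - \<sigma> h)"
    by (auto simp: fun_eq_iff signs_minus x simp flip: z)
  moreover have "\<exists>\<epsilon>. signs (z + \<epsilon> *\<^sub>R (- x)) = (\<lambda>k. if signs z k = 0 then signs (- x) k else signs z k)"
    using signs_perturb[of z "- x"] by (metis dense)
  ultimately have "\<sigma>(h := - \<sigma> h) \<in> range signs"
    by (metis rangeI)
  then show ?thesis
    using assms by (auto simp: covectors_def)
qed

text \<open>Two cells with a common facet have equal signs away from the hyperplane of the facet, so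
  being distinct they have opposite signs there.\<close>

lemma adjacent_iff:
  assumes "\<sigma> \<in> topes" "\<sigma>' \<in> topes"
  shows "(face \<sigma>, face \<sigma>') \<in> parcs (dual_graph H) \<longleftrightarrow> (\<exists>h\<in>walls \<sigma>. \<sigma>' = \<sigma>(h := - \<sigma> h))"
    (is "?L \<longleftrightarrow> ?R")
proof -
  have ne: "face \<sigma> \<noteq> face \<sigma>' \<longleftrightarrow> \<sigma> \<noteq> \<sigma>'"
    using face_eq_iff[of \<sigma> \<sigma>'] assms topes_subset by auto
  have "sides H (face \<sigma>) \<inter> sides H (face \<sigma>') =
      face ` ({\<tau> \<in> subtopes. conforms \<tau> \<sigma>} \<inter> {\<tau> \<in> subtopes. conforms \<tau> \<sigma>'})"
    using assms inj_on_face subtopes_subset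
    by (simp add: sides_eq inj_on_image_Int[of face "range signs"] subset_iff)
  then have L: "?L \<longleftrightarrow> \<sigma> \<noteq> \<sigma>' \<and> (\<exists>\<tau>\<in>subtopes. conforms \<tau> \<sigma> \<and> conforms \<tau> \<sigma>')"
    using assms ne by (auto simp: dual_graph_def cells_eq)
  show ?thesis
  proof
    assume ?L
    then obtain \<tau> where \<tau>: "\<sigma> \<noteq> \<sigma>'" "\<tau> \<in> subtopes" "conforms \<tau> \<sigma>" "conforms \<tau> \<sigma>'"
      using L by blast
    then obtain h where h: "h \<in> walls \<sigma>" "\<tau> = \<sigma>(h := 0)"
      using conforming_subtopes_eq[OF assms(1)] by blast
    have hH: "h \<in> H" using h by (simp add: walls_def)
    have same: "\<sigma>' k = \<sigma> k" if "k \<noteq> h" for k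
    proof (cases "k \<in> H")
      case True
      then show ?thesis using that \<tau>(4) h(2) assms(1) by (auto simp: conforms_def covectors_def)
    next
      case False
      then show ?thesis using assms covector_outside topes_subset by (metis subsetD)
    qed
    then have "\<sigma>' h \<noteq> \<sigma> h" using \<tau>(1) by (metis ext)
    then have "\<sigma>' h = - \<sigma> h"
      using tope_values[OF assms(1) hH] tope_values[OF assms(2) hH] by auto
    then have "\<sigma>' = \<sigma>(h := - \<sigma> h)"
      using same by (auto simp: fun_eq_iff)
    then show ?R using h by blast
  next
    assume ?R
    then obtain h where h: "h \<in> walls \<sigma>" "\<sigma>' = \<sigma>(h := - \<sigma> h)" by blast
    have "\<sigma> h \<noteq> 0"
      using assms(1) h by (auto simp: covectors_def walls_def)
    then have "\<sigma> \<noteq> \<sigma>'"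
      using h(2) by (metis equal_neg_zero fun_upd_same)
    moreover have "\<sigma>(h := 0) \<in> subtopes" "conforms (\<sigma>(h := 0)) \<sigma>" "conforms (\<sigma>(h := 0)) \<sigma>'"
      using conforming_subtopes_eq[OF assms(1)] h by (auto simp: conforms_def)
    ultimately show ?L using L by blast
  qed
qed

lemma card_conforming_subtopes:
  assumes "\<sigma> \<in> topes"
  shows "card {\<tau> \<in> subtopes. conforms \<tau> \<sigma>} = card (walls \<sigma>)"
proof -
  have "inj_on (\<lambda>h. \<sigma>(h := 0)) (walls \<sigma>)"
  proof (rule inj_onI)
    fix h k assume hk: "h \<in> walls \<sigma>" "k \<in> walls \<sigma>" "\<sigma>(h := 0) = \<sigma>(k := 0)"
    have "\<sigma> h \<noteq> 0"
      using hk(1) assms by (auto simp: walls_def covectors_def)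
    then show "h = k"
      using fun_cong[OF hk(3), of h] by (simp split: if_splits)
  qed
  then show ?thesis
    by (simp add: conforming_subtopes_eq[OF assms] card_image)
qed

lemma out_degree_eq_card_walls:
  assumes "\<sigma> \<in> topes"
  shows "out_degree (with_proj (dual_graph H)) (face \<sigma>) = card (walls \<sigma>)"
proof -
  let ?r = "\<lambda>h. \<sigma>(h := - \<sigma> h)"
  have "out_arcs (with_proj (dual_graph H)) (face \<sigma>) = (\<lambda>h. (face \<sigma>, face (?r h))) ` walls \<sigma>"
  proof (intro equalityI subsetI)
    fix e assume "e \<in> out_arcs (with_proj (dual_graph H)) (face \<sigma>)"
    then have e: "e \<in> parcs (dual_graph H)" "fst e = face \<sigma>"
      by (auto simp: out_arcs_def)
    then have "snd e \<in> face ` topes"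
      by (auto simp: dual_graph_def cells_eq)
    then obtain \<sigma>' where "\<sigma>' \<in> topes" "e = (face \<sigma>, face \<sigma>')"
      using e(2) by (cases e) auto
    then show "e \<in> (\<lambda>h. (face \<sigma>, face (?r h))) ` walls \<sigma>"
      using e(1) assms by (auto simp: adjacent_iff)
  next
    fix e assume "e \<in> (\<lambda>h. (face \<sigma>, face (?r h))) ` walls \<sigma>"
    then obtain h where h: "h \<in> walls \<sigma>" "e = (face \<sigma>, face (?r h))" by blast
    then have "e \<in> parcs (dual_graph H)"
      using adjacent_iff[OF assms reflection_in_wall[OF assms h(1)]] by blast
    then show "e \<in> out_arcs (with_proj (dual_graph H)) (face \<sigma>)"
      using h(2) by (simp add: out_arcs_def)
  qed
  moreover have "inj_on (\<lambda>h. (face \<sigma>, face (?r h))) (walls \<sigma>)"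
  proof (rule inj_onI)
    fix h k assume hk: "h \<in> walls \<sigma>" "k \<in> walls \<sigma>"
      "(face \<sigma>, face (?r h)) = (face \<sigma>, face (?r k))"
    have "?r h \<in> range signs" "?r k \<in> range signs"
      using reflection_in_wall[OF assms] hk topes_subset by auto
    then have eq: "?r h = ?r k"
      using hk(3) face_eq_iff[of "?r h" "?r k"] by simp
    have "\<sigma> h \<noteq> 0"
      using hk(1) assms by (auto simp: walls_def covectors_def)
    then show "h = k"
      using fun_cong[OF eq, of h] by (simp split: if_splits)
  qed
  ultimately show ?thesis
    by (simp add: out_degree_def card_image)
qed

lemma finite_cells: "finite (cells H)"
  unfolding cells_eq using finite_covectors topes_subset by (meson finite_imageI finite_subset)

lemma pair_graph_dual_graph: "pair_graph (dual_graph H)"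
proof
  show "finite (parcs (dual_graph H))"
    by (rule finite_subset[of _ "cells H \<times> cells H"]) (auto simp: dual_graph_def finite_cells)
  show "symmetric (with_proj (dual_graph H))"
    by (auto simp: symmetric_def sym_def dual_graph_def)
qed (auto simp: dual_graph_def finite_cells)

text \<open>Walk from a point \<open>x\<close> of the first cell to a point \<open>y\<close> of the second one. If \<open>y\<close> is
  generic, the segment meets the separating hyperplanes at pairwise different times. At the
  first such time it has left the first cell through one hyperplane only, so that this
  hyperplane is a wall.\<close>

lemma exists_separating_wall:
  assumes "\<sigma> \<in> topes" "\<sigma>' \<in> topes" "\<sigma> \<noteq> \<sigma>'"
  shows "\<exists>h\<in>walls \<sigma>. \<sigma>' h \<noteq> \<sigma> h"
proof -
  obtain x where x: "\<sigma> = signs x" using assms by (auto simp: covectors_def)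
  define f where "f h v = normal h \<bullet> v" for h v
  \<comment> \<open>For separating \<open>h\<close> and \<open>k\<close>, the vector is orthogonal to \<open>y\<close> iff the segment from \<open>x\<close> to
      \<open>y\<close> crosses both at the same time.\<close>
  define N where "N = {f h x *\<^sub>R normal k - f k x *\<^sub>R normal h | h k. h \<in> H \<and> k \<in> H \<and> h \<noteq> k}"
  have fx: "f h x \<noteq> 0" if "h \<in> H" for h
    using that assms(1) by (auto simp: x covectors_def signs_def f_def sgn_0_0)
  have "N \<subseteq> (\<lambda>(h, k). f h x *\<^sub>R normal k - f k x *\<^sub>R normal h) ` (H \<times> H)"
    by (auto simp: N_def)
  then have finN: "finite N"
    using finite_H finite_subset by blast
  have N0: "0 \<notin> N"
  proof
    assume "0 \<in> N"
    then obtain h k where hk: "h \<in> H" "k \<in> H" "h \<noteq> k" "f h x *\<^sub>R normal k = f k x *\<^sub>R normal h"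
      by (auto simp: N_def)
    then have "f h x * (normal k \<bullet> v) = f k x * (normal h \<bullet> v)" for v
      by (metis inner_scaleR_left)
    then have "normal k \<bullet> v = 0 \<longleftrightarrow> normal h \<bullet> v = 0" for v
      using fx hk by (metis mult_eq_0_iff)
    then have "h = k"
      using hyperplane_eq hk by auto
    then show False using hk by simp
  qed
  have "\<sigma>' \<in> range signs"
    using assms(2) topes_subset by blast
  then have "open (face \<sigma>')" "face \<sigma>' \<noteq> {}"
    using face_nonempty open_star face_tope_eq_star[OF assms(2)] by auto
  then obtain y where "y \<in> face \<sigma>'" and yN: "\<forall>a\<in>N. a \<bullet> y \<noteq> 0"
    using exists_generic_point[OF _ _ finN N0] by blast
  then have y: "\<sigma>' = signs y"
    by (simp add: face_def)
  have fy: "f h y \<noteq> 0" if "h \<in> H" for h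
    using that assms(2) by (auto simp: y covectors_def signs_def f_def sgn_0_0)
  define D where "D = {h \<in> H. \<sigma> h \<noteq> \<sigma>' h}"
  \<comment> \<open>The time at which the segment crosses \<open>h\<close>.\<close>
  define t where "t h = f h x / (f h x - f h y)" for h
  have finD: "finite D" using finite_H by (simp add: D_def)
  have "D \<noteq> {}"
  proof
    assume "D = {}"
    then have "\<sigma> h = \<sigma>' h" for h
      by (cases "h \<in> H") (auto simp: D_def x y signs_def)
    then show False using assms(3) by blast
  qed
  then obtain h where h: "h \<in> D" "\<And>k. k \<in> D \<Longrightarrow> t h \<le> t k"
    using ex_min_if_finite[of "t ` D"] finD by (auto simp: not_less)
  have hH: "h \<in> H" using h by (simp add: D_def)
  have opp: "(f k x > 0 \<and> f k y < 0) \<or> (f k x < 0 \<and> f k y > 0)" if "k \<in> D" for k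
    using that fx[of k] fy[of k] by (auto simp: D_def x y signs_def f_def sgn_if split: if_splits)
  have t01: "0 < t h" "t h < 1"
    using opp[OF h(1)] by (auto simp: t_def field_simps)
  have strict: "t h < t k" if k: "k \<in> D" "k \<noteq> h" for k
  proof -
    have "k \<in> H" using k by (simp add: D_def)
    then have "f h x *\<^sub>R normal k - f k x *\<^sub>R normal h \<in> N"
      using hH k by (auto simp: N_def)
    then have "f h x * f k y \<noteq> f k x * f h y"
      using yN by (auto simp: inner_diff_left f_def)
    then have "t h \<noteq> t k"
      using opp[OF h(1)] opp[OF k(1)] by (auto simp: t_def field_simps)
    then show ?thesis using h(2)[OF k(1)] by simp
  qed
  define z where "z = x + t h *\<^sub>R (y - x)"
  have fz: "f k z = (1 - t h) * f k x + t h * f k y" for k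
    by (simp add: z_def f_def inner_add_right inner_diff_right algebra_simps)
  have "signs z k = (\<sigma>(h := 0)) k" for k
  proof -
    consider "k \<notin> H" | "k = h" | "k \<in> D" "k \<noteq> h" | "k \<in> H" "k \<notin> D" by blast
    then show ?thesis
    proof cases
      case 1
      then show ?thesis using hH by (auto simp: signs_def x)
    next
      case 2
      have "f h z = 0"
        using opp[OF h(1)] by (auto simp: fz t_def field_simps)
      then show ?thesis using 2 by (simp add: signs_def f_def)
    next
      case 3
      have "f k z = (f k x - f k y) * (t k - t h)"
        using opp[OF 3(1)] by (auto simp: fz t_def[of k] field_simps)
      then have "sgn (f k z) = sgn (f k x - f k y)"
        using strict[OF 3] by (simp add: sgn_mult)
      also have "\<dots> = sgn (f k x)"
        using opp[OF 3(1)] by (auto simp: sgn_if)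
      finally show ?thesis
        using 3 by (simp add: signs_def x f_def D_def)
    next
      case 4
      then have "sgn (f k x) = sgn (f k y)"
        by (simp add: D_def x y signs_def f_def)
      then have "(f k x > 0 \<and> f k y > 0) \<or> (f k x < 0 \<and> f k y < 0)"
        using fx[OF 4(1)] fy[OF 4(1)] by (auto simp: sgn_if split: if_splits)
      then have "(f k x > 0 \<and> f k z > 0) \<or> (f k x < 0 \<and> f k z < 0)"
        unfolding fz using t01 by (auto intro!: add_pos_pos add_neg_neg mult_pos_neg)
      then show ?thesis
        using 4 h(1) by (auto simp: signs_def x f_def sgn_if)
    qed
  qed
  then have "signs z = \<sigma>(h := 0)" by blast
  then have "h \<in> walls \<sigma>"
    using hH rangeI[of signs z] by (simp add: walls_def)
  then show ?thesis
    using h(1) by (auto simp: D_def intro!: bexI[of _ h])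
qed

text \<open>A cell is labelled by the set of hyperplanes on whose positive side it lies, so the
  symmetric difference of two labels consists of the separating hyperplanes.\<close>

lemma partial_cube_dual_graph: "partial_cube (dual_graph H)"
proof (rule partial_cube_of_set_labels[OF pair_graph_dual_graph finite_H])
  define lab where "lab c = {h \<in> H. \<exists>x\<in>c. signs x h = 1}" for c
  have lab_face: "lab (face \<sigma>) = {h \<in> H. \<sigma> h = 1}" if "\<sigma> \<in> topes" for \<sigma>
    using that by (auto simp: lab_def face_def covectors_def)
  have sym_diff_lab: "sym_diff (lab (face \<sigma>)) (lab (face \<sigma>')) = {h \<in> H. \<sigma> h \<noteq> \<sigma>' h}"
    if "\<sigma> \<in> topes" "\<sigma>' \<in> topes" for \<sigma> \<sigma>'
  proof -
    have "\<sigma> h \<noteq> \<sigma>' h \<longleftrightarrow> (\<sigma> h = 1) \<noteq> (\<sigma>' h = 1)" if "h \<in> H" for h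
      using tope_values[OF \<open>\<sigma> \<in> topes\<close> that] tope_values[OF \<open>\<sigma>' \<in> topes\<close> that] by auto
    then show ?thesis
      using that by (auto simp: lab_face)
  qed
  have verts: "pverts (dual_graph H) = face ` topes"
    by (simp add: dual_graph_def cells_eq)
  show "lab v \<subseteq> H" for v by (auto simp: lab_def)
  show "card (sym_diff (lab u) (lab v)) = 1" if uv: "(u, v) \<in> parcs (dual_graph H)" for u v
  proof -
    have "u \<in> face ` topes" "v \<in> face ` topes"
      using uv by (auto simp: dual_graph_def cells_eq)
    then obtain \<sigma> \<sigma>' where s: "\<sigma> \<in> topes" "\<sigma>' \<in> topes" "u = face \<sigma>" "v = face \<sigma>'"
      by (elim imageE) simp
    then obtain h where h: "h \<in> walls \<sigma>" "\<sigma>' = \<sigma>(h := - \<sigma> h)"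
      using uv adjacent_iff[OF s(1,2)] s(3,4) by auto
    then have "{k \<in> H. \<sigma> k \<noteq> \<sigma>' k} = {h}"
      using s(1) by (auto simp: walls_def covectors_def)
    then show ?thesis
      using s by (simp add: sym_diff_lab)
  qed
  show "\<exists>w. (u, w) \<in> parcs (dual_graph H) \<and>
      card (sym_diff (lab w) (lab v)) < card (sym_diff (lab u) (lab v))"
    if uv: "u \<in> pverts (dual_graph H)" "v \<in> pverts (dual_graph H)" "u \<noteq> v" for u v
  proof -
    obtain \<sigma> \<sigma>' where s: "\<sigma> \<in> topes" "\<sigma>' \<in> topes" "u = face \<sigma>" "v = face \<sigma>'"
      using uv(1,2) unfolding verts by (elim imageE) simp
    then obtain h where h: "h \<in> walls \<sigma>" "\<sigma>' h \<noteq> \<sigma> h"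
      using exists_separating_wall[OF s(1,2)] uv(3) s(3,4) by auto
    let ?r = "\<sigma>(h := - \<sigma> h)"
    have r: "?r \<in> topes" by (rule reflection_in_wall[OF s(1) h(1)])
    have hH: "h \<in> H" using h by (simp add: walls_def)
    have "\<sigma>' h = - \<sigma> h"
      using h(2) tope_values[OF s(1) hH] tope_values[OF s(2) hH] by auto
    then have "{k \<in> H. ?r k \<noteq> \<sigma>' k} = {k \<in> H. \<sigma> k \<noteq> \<sigma>' k} - {h}"
      by (auto split: if_splits)
    moreover have "h \<in> {k \<in> H. \<sigma> k \<noteq> \<sigma>' k}"
      using h(2) hH by simp
    ultimately have "card {k \<in> H. ?r k \<noteq> \<sigma>' k} < card {k \<in> H. \<sigma> k \<noteq> \<sigma>' k}"
      using card_Diff1_less[of "{k \<in> H. \<sigma> k \<noteq> \<sigma>' k}" h] finite_H by simp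
    then have "card (sym_diff (lab (face ?r)) (lab v)) < card (sym_diff (lab u) (lab v))"
      using s r by (simp add: sym_diff_lab)
    moreover have "(u, face ?r) \<in> parcs (dual_graph H)"
      unfolding s(3) adjacent_iff[OF s(1) r] using h(1) by blast
    ultimately show ?thesis by blast
  qed
qed

end

section \<open>From the projective plane to space\<close>

lemma origin_line_proj_point: "v \<noteq> 0 \<Longrightarrow> origin_line (proj_point v) = span {v}"
  unfolding proj_point_def by (rule Abs_proj_plane_inverse) (simp add: dim_eq_card_independent)

lemma proj_point_cases:
  obtains v where "v \<noteq> 0" "p = proj_point v"
proof -
  have p: "subspace (origin_line p)" "dim (origin_line p) = 1"
    using origin_line[of p] by auto
  then obtain B where B: "B \<subseteq> origin_line p" "independent B" "origin_line p \<subseteq> span B" "card B = 1"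
    using basis_exists by metis
  then obtain v where v: "B = {v}"
    by (auto simp: card_1_singleton_iff)
  have "origin_line p = span {v}"
    using B p(1) v by (metis span_minimal subset_antisym)
  then have "p = proj_point v"
    using origin_line_inverse[of p] by (simp add: proj_point_def)
  moreover have "v \<noteq> 0"
    using B(2) v by (auto simp: dependent_zero)
  ultimately show ?thesis
    using that by blast
qed

lemma proj_point_eq_iff:
  assumes "v \<noteq> 0" "w \<noteq> 0"
  shows "proj_point v = proj_point w \<longleftrightarrow> (\<exists>c. c \<noteq> 0 \<and> v = c *\<^sub>R w)"
proof
  assume "proj_point v = proj_point w"
  then have "span {v} = span {w}"
    using assms origin_line_proj_point by metis
  then have "v \<in> span {w}"
    by (metis insertI1 span_base)
  then show "\<exists>c. c \<noteq> 0 \<and> v = c *\<^sub>R w"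
    using assms by (auto simp: span_singleton)
next
  assume "\<exists>c. c \<noteq> 0 \<and> v = c *\<^sub>R w"
  then obtain c where "c \<noteq> 0" "v = c *\<^sub>R w" by blast
  then have "span {v} = span {w}"
    using span_image_scale[of "{w}" "\<lambda>_. c"] by simp
  then show "proj_point v = proj_point w"
    by (simp add: proj_point_def)
qed

lemma continuous_on_proj_point: "0 \<notin> S \<Longrightarrow> continuous_on S proj_point"
proof -
  assume S: "0 \<notin> S"
  show ?thesis
    unfolding continuous_on_open_invariant
  proof (intro allI impI)
    fix B :: "proj_plane set" assume "open B"
    then have "open {v. v \<noteq> 0 \<and> proj_point v \<in> B}"
      by (simp add: open_proj_plane_def)
    moreover have "{v. v \<noteq> 0 \<and> proj_point v \<in> B} \<inter> S = proj_point -` B \<inter> S"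
      using S by auto
    ultimately show "\<exists>T. open T \<and> T \<inter> S = proj_point -` B \<inter> S"
      by blast
  qed
qed

text \<open>The preimage of the image of \<open>U\<close> is the union of all nonzero multiples of \<open>U\<close>.\<close>

lemma open_image_proj_point:
  assumes "open U" "0 \<notin> U"
  shows "open (proj_point ` U)"
proof -
  have "{v. v \<noteq> 0 \<and> proj_point v \<in> proj_point ` U} = (\<Union>c\<in>-{0}. (\<lambda>u. c *\<^sub>R u) ` U)"
  proof (intro equalityI subsetI)
    fix v assume "v \<in> {v. v \<noteq> 0 \<and> proj_point v \<in> proj_point ` U}"
    then obtain u where u: "v \<noteq> 0" "u \<in> U" "proj_point v = proj_point u" by auto
    moreover have "u \<noteq> 0" using assms(2) u by blast
    ultimately show "v \<in> (\<Union>c\<in>-{0}. (\<lambda>u. c *\<^sub>R u) ` U)"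
      by (auto simp: proj_point_eq_iff)
  next
    fix v assume "v \<in> (\<Union>c\<in>-{0}. (\<lambda>u. c *\<^sub>R u) ` U)"
    then obtain c u where "c \<noteq> 0" "u \<in> U" "v = c *\<^sub>R u" by auto
    moreover have "u \<noteq> 0" using assms(2) calculation by blast
    ultimately have "v \<noteq> 0" "proj_point v = proj_point u"
      by (auto simp: proj_point_eq_iff)
    then show "v \<in> {v. v \<noteq> 0 \<and> proj_point v \<in> proj_point ` U}"
      using \<open>u \<in> U\<close> by auto
  qed
  then show ?thesis
    unfolding open_proj_plane_def using assms(1) by (auto intro!: open_UN open_scaling)
qed

lemma lift_line_of_subspace:
  assumes "subspace P" "dim P = 2"
  shows "lift_line {p. origin_line p \<subseteq> P} = P"
proof (intro equalityI subsetI)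
  fix v assume v: "v \<in> P"
  have on_line: "u \<in> lift_line {p. origin_line p \<subseteq> P}" if "w \<noteq> 0" "w \<in> P" "u \<in> span {w}" for u w
  proof -
    have "origin_line (proj_point w) \<subseteq> P"
      using that(1,2) assms(1) span_minimal[of "{w}" P] by (simp add: origin_line_proj_point)
    then show ?thesis
      using that(1,3) unfolding lift_line_def
      by (intro UN_I[of "proj_point w"]) (simp_all add: origin_line_proj_point)
  qed
  show "v \<in> lift_line {p. origin_line p \<subseteq> P}"
  proof (cases "v = 0")
    case True
    \<comment> \<open>The origin is in the lift because the plane contains some line through it.\<close>
    have "\<not> P \<subseteq> {0}"
      using assms(2) by (metis dim_eq_0 zero_neq_numeral)
    then obtain w where "w \<noteq> 0" "w \<in> P" by blast
    then show ?thesis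
      using on_line[of w v] True by (simp add: span_zero)
  next
    case False
    then show ?thesis using on_line[of v v] v by (simp add: span_base)
  qed
qed (auto simp: lift_line_def)

lemma proj_point_in_line_iff:
  assumes "proj_line l" "v \<noteq> 0"
  shows "proj_point v \<in> l \<longleftrightarrow> v \<in> lift_line l"
proof -
  obtain P where P: "subspace P" "dim P = 2" "l = {p. origin_line p \<subseteq> P}"
    using assms(1) by (auto simp: proj_line_def)
  have "proj_point v \<in> l \<longleftrightarrow> span {v} \<subseteq> P"
    using assms(2) by (simp add: P(3) origin_line_proj_point)
  also have "\<dots> \<longleftrightarrow> v \<in> P"
    using P(1) by (metis bot.extremum insert_subset span_eq_iff span_minimal span_superset subset_trans)
  finally show ?thesis
    using P lift_line_of_subspace by simp
qed

lemma lift_line_hyperplane: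
  assumes "proj_line l"
  shows "\<exists>a. a \<noteq> 0 \<and> lift_line l = {x. a \<bullet> x = 0}"
proof -
  obtain P where P: "subspace P" "dim P = 2" "lift_line l = P"
    using assms lift_line_of_subspace by (auto simp: proj_line_def)
  have "dim P < DIM(real^3)" using P(2) by simp
  then obtain a where a: "a \<noteq> 0" "span P \<subseteq> {x. a \<bullet> x = 0}"
    using lowdim_subset_hyperplane by blast
  then have "P \<subseteq> {x. a \<bullet> x = 0}"
    using span_superset[of P] by blast
  then have "P = {x. a \<bullet> x = 0}"
    using P a(1) by (intro subspace_dim_equal) (simp_all add: subspace_hyperplane dim_hyperplane)
  then show ?thesis using a P by blast
qed

lemma inj_on_lift_line: "inj_on lift_line {l. proj_line l}"
proof (rule inj_onI)
  fix l m assume "l \<in> {l. proj_line l}" "m \<in> {l. proj_line l}" "lift_line l = lift_line m"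
  then have "proj_point v \<in> l \<longleftrightarrow> proj_point v \<in> m" if "v \<noteq> 0" for v
    using that by (simp add: proj_point_in_line_iff)
  then show "l = m"
    by (metis proj_point_cases subsetI subset_antisym)
qed

section \<open>Projective arrangements and sign vectors up to sign\<close>

lemma minus_minus_fun: "- (- f) = f" for f :: "'a \<Rightarrow> 'b::group_add"
  by (simp add: fun_eq_iff)

text \<open>Because there are at least two lines, every facet of the lifted arrangement avoids the
  origin and differs from its antipodal facet. For a single line the only facet would be a whole
  plane through the origin.\<close>

locale projective_arrangement =
  fixes A :: "proj_plane set set" and normal :: "(real^3) set \<Rightarrow> real^3"
  assumes arrangement: "line_arrangement A"
    and two_lines: "2 \<le> card A"
    and normal_of_lift: "l \<in> A \<Longrightarrow> normal (lift_line l) \<noteq> 0 \<and>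
      lift_line l = {x. normal (lift_line l) \<bullet> x = 0}"
begin

sublocale central_arrangement "lift_arrangement A" normal
proof
  show "finite (lift_arrangement A)"
    using arrangement by (simp add: lift_arrangement_def line_arrangement_def)
qed (use normal_of_lift in \<open>auto simp: lift_arrangement_def\<close>)

definition proj_face :: "((real^3) set \<Rightarrow> real) \<Rightarrow> proj_plane set" where
  "proj_face \<rho> = proj_point ` face \<rho>"

lemma line_in_A: "l \<in> A \<Longrightarrow> proj_line l"
  using arrangement by (simp add: line_arrangement_def)

lemma ball_lift_arrangement: "(\<forall>h\<in>lift_arrangement A. P h) \<longleftrightarrow> (\<forall>l\<in>A. P (lift_line l))"
  by (simp add: lift_arrangement_def)

lemma UN_lift_arrangement: "(\<Union>h\<in>lift_arrangement A. P h) = (\<Union>l\<in>A. P (lift_line l))"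
  by (simp add: lift_arrangement_def)

lemma card_lift_arrangement: "card (lift_arrangement A) = card A"
  unfolding lift_arrangement_def
  by (intro card_image inj_on_subset[OF inj_on_lift_line]) (auto simp: line_in_A)

lemma lift_line_eq_iff: "l \<in> A \<Longrightarrow> m \<in> A \<Longrightarrow> lift_line l = lift_line m \<longleftrightarrow> l = m"
  using inj_on_lift_line line_in_A by (auto simp: inj_on_def)

text \<open>Cells and facets do not contain the origin, so that projecting them makes sense.\<close>

lemma nonzero_covector:
  assumes "\<rho> \<in> covectors Z" "card Z \<le> 1" "finite Z"
  shows "\<exists>h\<in>lift_arrangement A. \<rho> h \<noteq> 0"
proof -
  have "\<not> lift_arrangement A \<subseteq> Z"
    using card_mono[OF assms(3), of "lift_arrangement A"] assms(2) two_lines card_lift_arrangement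
    by auto
  then show ?thesis
    using assms(1) by (auto simp: covectors_def)
qed

lemma zero_notin_star:
  assumes "h \<in> lift_arrangement A" "\<rho> h \<noteq> 0"
  shows "0 \<notin> star \<rho>"
  using assms by (auto simp: star_def signs_0)

text \<open>Scaling by a positive factor keeps all signs, by a negative factor reverses all of them.\<close>

lemma proj_point_in_proj_face_iff:
  assumes "v \<noteq> 0" "0 \<notin> face \<rho>"
  shows "proj_point v \<in> proj_face \<rho> \<longleftrightarrow> signs v = \<rho> \<or> signs v = - \<rho>"
proof
  assume "proj_point v \<in> proj_face \<rho>"
  then obtain w where w: "w \<in> face \<rho>" "proj_point v = proj_point w"
    by (auto simp: proj_face_def)
  then have "w \<noteq> 0" using assms(2) by blast
  then obtain c where c: "c \<noteq> 0" "v = c *\<^sub>R w"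
    using w(2) assms(1) proj_point_eq_iff by blast
  have "signs v = \<rho>" if "c > 0"
    using w(1) c that by (simp add: face_def signs_scaleR)
  moreover have "signs v = - \<rho>" if "c < 0"
  proof -
    have "v = - ((- c) *\<^sub>R w)" using c by simp
    then show ?thesis
      using w(1) that signs_scaleR[of "- c" w] signs_minus[of "(- c) *\<^sub>R w"] by (simp add: face_def)
  qed
  ultimately show "signs v = \<rho> \<or> signs v = - \<rho>"
    using c(1) by linarith
next
  assume "signs v = \<rho> \<or> signs v = - \<rho>"
  then show "proj_point v \<in> proj_face \<rho>"
  proof
    assume "signs v = \<rho>"
    then show ?thesis by (auto simp: proj_face_def face_def)
  next
    assume "signs v = - \<rho>"
    then have "- v \<in> face \<rho>"
      by (auto simp: face_def signs_minus fun_eq_iff)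
    moreover have "proj_point v = proj_point (- v)"
      using assms(1) by (subst proj_point_eq_iff) (auto intro!: exI[of _ "-1"])
    ultimately show ?thesis by (auto simp: proj_face_def)
  qed
qed

lemma zero_notin_face:
  assumes "\<rho> \<in> covectors Z" "card Z \<le> 1" "finite Z"
  shows "0 \<notin> face \<rho>"
  using nonzero_covector[OF assms] by (auto simp: face_def signs_0)

lemma proj_face_eq_iff:
  assumes "\<rho> \<in> covectors Z" "card Z \<le> 1" "finite Z"
    and "\<rho>' \<in> covectors Z'" "card Z' \<le> 1" "finite Z'"
  shows "proj_face \<rho> = proj_face \<rho>' \<longleftrightarrow> \<rho>' = \<rho> \<or> \<rho>' = - \<rho>"
proof -
  have z: "0 \<notin> face \<rho>" "0 \<notin> face \<rho>'"
    using assms zero_notin_face by auto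
  obtain v where v: "\<rho> = signs v"
    using assms(1) by (auto simp: covectors_def)
  then have v0: "v \<noteq> 0" using z(1) by (auto simp: face_def)
  show ?thesis
  proof
    assume "proj_face \<rho> = proj_face \<rho>'"
    moreover have "proj_point v \<in> proj_face \<rho>"
      using proj_point_in_proj_face_iff[OF v0 z(1)] v by simp
    ultimately have "proj_point v \<in> proj_face \<rho>'"
      by simp
    then show "\<rho>' = \<rho> \<or> \<rho>' = - \<rho>"
      using proj_point_in_proj_face_iff[OF v0 z(2)] v minus_minus_fun[of \<rho>'] by auto
  next
    assume eq: "\<rho>' = \<rho> \<or> \<rho>' = - \<rho>"
    have "proj_point w \<in> proj_face \<rho> \<longleftrightarrow> proj_point w \<in> proj_face \<rho>'" if "w \<noteq> 0" for w
      using eq proj_point_in_proj_face_iff[OF that z(1)] proj_point_in_proj_face_iff[OF that z(2)]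
        minus_minus_fun[of \<rho>] by auto
    then show "proj_face \<rho> = proj_face \<rho>'"
      by (intro set_eqI) (metis proj_point_cases)
  qed
qed

text \<open>The projected faces are connected by continuity. They are relatively open because the
  stars of the faces, which avoid the origin, have open images.\<close>

lemma components_of_proj_stratum:
  assumes Z: "card Z \<le> 1" "finite Z"
    and X: "\<And>v. v \<noteq> 0 \<Longrightarrow> proj_point v \<in> X \<longleftrightarrow> signs v \<in> covectors Z"
  shows "components X = proj_face ` covectors Z"
proof (rule components_of_open_partition)
  note mem = proj_point_in_proj_face_iff[OF _ zero_notin_face[OF _ Z]]
  show "\<Union>(proj_face ` covectors Z) = X"
  proof (intro set_eqI)
    fix p
    obtain v where v: "v \<noteq> 0" "p = proj_point v" by (rule proj_point_cases)
    have "p \<in> \<Union>(proj_face ` covectors Z) \<longleftrightarrow>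
        (\<exists>\<rho>\<in>covectors Z. signs v = \<rho> \<or> signs v = - \<rho>)"
      using v mem by auto
    also have "\<dots> \<longleftrightarrow> signs v \<in> covectors Z"
      using minus_covectors by auto
    also have "\<dots> \<longleftrightarrow> p \<in> X"
      using v X by simp
    finally show "p \<in> \<Union>(proj_face ` covectors Z) \<longleftrightarrow> p \<in> X" .
  qed
next
  fix C D assume "C \<in> proj_face ` covectors Z" "D \<in> proj_face ` covectors Z" "C \<inter> D \<noteq> {}"
  then obtain \<rho> \<rho>' p where \<rho>: "\<rho> \<in> covectors Z" "\<rho>' \<in> covectors Z" "C = proj_face \<rho>" "D = proj_face \<rho>'"
    and p: "p \<in> C" "p \<in> D"
    by (elim imageE) auto
  obtain v where v: "v \<noteq> 0" "p = proj_point v" by (rule proj_point_cases)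
  have "signs v = \<rho> \<or> signs v = - \<rho>" "signs v = \<rho>' \<or> signs v = - \<rho>'"
    using p \<rho> v proj_point_in_proj_face_iff[OF v(1) zero_notin_face[OF \<rho>(1) Z]]
      proj_point_in_proj_face_iff[OF v(1) zero_notin_face[OF \<rho>(2) Z]] by auto
  then have "\<rho>' = \<rho> \<or> \<rho>' = - \<rho>"
    by (metis minus_minus_fun)
  then show "C = D"
    using proj_face_eq_iff[OF \<rho>(1) Z \<rho>(2) Z] \<rho>(3,4) by simp
next
  fix C assume "C \<in> proj_face ` covectors Z"
  then obtain \<rho> where \<rho>: "\<rho> \<in> covectors Z" "C = proj_face \<rho>"
    by blast
  then have r: "\<rho> \<in> range signs"
    by (simp add: covectors_def)
  show "C \<noteq> {}"
    using face_nonempty[OF r] \<rho>(2) by (simp add: proj_face_def)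
  show "connected C"
    unfolding \<rho>(2) proj_face_def
    by (intro connected_continuous_image continuous_on_proj_point connected_face r
        zero_notin_face[OF \<rho>(1) Z])
  obtain h where h: "h \<in> lift_arrangement A" "\<rho> h \<noteq> 0"
    using nonzero_covector[OF \<rho>(1) Z] by blast
  then have star0: "0 \<notin> star \<rho>"
    by (rule zero_notin_star)
  have "C = X \<inter> proj_point ` star \<rho>"
  proof (intro equalityI subsetI)
    fix p assume "p \<in> C"
    then obtain v where v: "v \<in> face \<rho>" "p = proj_point v"
      using \<rho>(2) by (auto simp: proj_face_def)
    moreover from this have "v \<noteq> 0" "v \<in> star \<rho>"
      using zero_notin_face[OF \<rho>(1) Z] face_subset_star by auto
    ultimately show "p \<in> X \<inter> proj_point ` star \<rho>"
      using X[of v] \<rho>(1) by (simp add: face_def)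
  next
    fix p assume "p \<in> X \<inter> proj_point ` star \<rho>"
    then obtain v where v: "v \<in> star \<rho>" "p = proj_point v" "proj_point v \<in> X"
      by auto
    then have "v \<noteq> 0" using star0 by blast
    then have "v \<in> face \<rho>"
      using star_Int_covectors[OF \<rho>(1) v(1)] X[of v] v(3) by blast
    then show "p \<in> C"
      using v(2) \<rho>(2) by (simp add: proj_face_def)
  qed
  moreover have "open (proj_point ` star \<rho>)"
    by (rule open_image_proj_point[OF open_star[OF r] star0])
  ultimately show "openin (top_of_set X) C"
    by (auto simp: openin_open)
qed

lemma signs_zero_on_lift_iff:
  "l \<in> A \<Longrightarrow> v \<noteq> 0 \<Longrightarrow> signs v (lift_line l) = 0 \<longleftrightarrow> proj_point v \<in> l"
  using signs_eq_0_iff[of "lift_line l" v] proj_point_in_line_iff[of l v] line_in_A[of l]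
  by (simp add: lift_arrangement_def)

lemma proj_cells_eq: "cells A = proj_face ` topes"
  unfolding cells_def
proof (rule components_of_proj_stratum)
  fix v :: "real^3" assume "v \<noteq> 0"
  then show "proj_point v \<in> - \<Union>A \<longleftrightarrow> signs v \<in> topes"
    by (auto simp: covectors_def ball_lift_arrangement signs_zero_on_lift_iff)
qed auto

lemma proj_facets_eq: "facets A = proj_face ` subtopes"
proof -
  have "components (l - \<Union>(A - {l})) = proj_face ` covectors {lift_line l}" if l: "l \<in> A" for l
  proof (rule components_of_proj_stratum)
    fix v :: "real^3" assume v: "v \<noteq> 0"
    have "signs v \<in> covectors {lift_line l} \<longleftrightarrow> (\<forall>m\<in>A. proj_point v \<in> m \<longleftrightarrow> m = l)"
      using v l by (simp add: covectors_def ball_lift_arrangement signs_zero_on_lift_iff lift_line_eq_iff)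
    then show "proj_point v \<in> l - \<Union>(A - {l}) \<longleftrightarrow> signs v \<in> covectors {lift_line l}"
      using l by auto
  qed auto
  then show ?thesis
    by (simp add: facets_def subtopes_def UN_lift_arrangement image_UN)
qed

lemma tope_zero: "\<sigma> \<in> topes \<Longrightarrow> 0 \<notin> face \<sigma>"
  by (rule zero_notin_face) auto

lemma subtope_cases:
  assumes "\<tau> \<in> subtopes"
  obtains h where "h \<in> lift_arrangement A" "\<tau> \<in> covectors {h}"
  using assms by (auto simp: subtopes_def)

text \<open>The preimage of a projected cell is the union of the cell and its antipode, and the
  projection is continuous and open, so closures can be compared in space.\<close>

lemma proj_point_in_closure_iff:
  assumes "\<sigma> \<in> topes" "\<tau> \<in> subtopes" "signs v = \<tau>" "v \<noteq> 0"
  shows "proj_point v \<in> closure (proj_face \<sigma>) \<longleftrightarrow> conforms \<tau> \<sigma> \<or> conforms \<tau> (- \<sigma>)"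
proof
  obtain k where "k \<in> lift_arrangement A" "\<tau> \<in> covectors {k}"
    using assms(2) by (rule subtope_cases)
  then obtain h where h: "h \<in> lift_arrangement A" "\<tau> h \<noteq> 0"
    using nonzero_covector[of \<tau> "{k}"] by auto
  have r: "\<tau> \<in> range signs" using assms(3) by blast
  have star0: "0 \<notin> star \<tau>"
    using h by (rule zero_notin_star)
  assume "proj_point v \<in> closure (proj_face \<sigma>)"
  moreover have "open (proj_point ` star \<tau>)"
    by (rule open_image_proj_point[OF open_star[OF r] star0])
  moreover have "proj_point v \<in> proj_point ` star \<tau>"
    using assms(3) by (auto simp: star_def)
  ultimately have "proj_point ` star \<tau> \<inter> proj_face \<sigma> \<noteq> {}"
    using open_Int_closure_eq_empty[of "proj_point ` star \<tau>" "proj_face \<sigma>"] by auto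
  then obtain y where y: "y \<in> star \<tau>" "proj_point y \<in> proj_face \<sigma>"
    by auto
  then have "y \<noteq> 0" using star0 by blast
  then have "signs y = \<sigma> \<or> signs y = - \<sigma>"
    using y(2) proj_point_in_proj_face_iff[OF _ tope_zero[OF assms(1)]] by simp
  moreover have "conforms \<tau> (signs y)"
    using y(1) assms(3) signs_outside by (auto simp: conforms_def star_def)
  ultimately show "conforms \<tau> \<sigma> \<or> conforms \<tau> (- \<sigma>)"
    by auto
next
  have conv: "proj_point v \<in> closure (proj_face \<rho>)" if "\<rho> \<in> topes" "conforms \<tau> \<rho>" for \<rho>
  proof -
    have v: "v \<in> closure (face \<rho>)"
      using closure_face[OF tope_covector[OF that(1)]] that(2) assms(3) by simp
    have "proj_face \<rho> \<inter> V \<noteq> {}" if V: "open V" "proj_point v \<in> V" for V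
    proof -
      let ?U = "{w. w \<noteq> 0 \<and> proj_point w \<in> V}"
      have "open ?U" using V(1) by (simp add: open_proj_plane_def)
      moreover have "v \<in> ?U" using assms(4) V(2) by simp
      ultimately obtain w where "w \<in> face \<rho>" "w \<in> ?U"
        using v open_Int_closure_eq_empty[of ?U "face \<rho>"] by auto
      then show ?thesis by (auto simp: proj_face_def)
    qed
    from this[of "- closure (proj_face \<rho>)"] show ?thesis
      using closure_subset[of "proj_face \<rho>"] by auto
  qed
  assume "conforms \<tau> \<sigma> \<or> conforms \<tau> (- \<sigma>)"
  moreover have "proj_face (- \<sigma>) = proj_face \<sigma>"
    using proj_face_eq_iff[OF assms(1) _ _ minus_covectors[OF assms(1)]] by simp
  ultimately show "proj_point v \<in> closure (proj_face \<sigma>)"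
    using conv[of \<sigma>] conv[of "- \<sigma>"] assms(1) minus_covectors[OF assms(1)] by auto
qed

lemma proj_face_subset_frontier_iff:
  assumes "\<sigma> \<in> topes" "\<tau> \<in> subtopes"
  shows "proj_face \<tau> \<subseteq> frontier (proj_face \<sigma>) \<longleftrightarrow> conforms \<tau> \<sigma> \<or> conforms \<tau> (- \<sigma>)"
proof -
  obtain h where h: "\<tau> \<in> covectors {h}"
    using assms(2) by (rule subtope_cases)
  have t0: "0 \<notin> face \<tau>"
    using zero_notin_face[OF h] by simp
  have "open (proj_face \<sigma>)"
    unfolding proj_face_def face_tope_eq_star[OF assms(1)]
    using open_image_proj_point[OF open_star[OF tope_covector[OF assms(1)]]]
      tope_zero[OF assms(1)] face_tope_eq_star[OF assms(1)] by simp
  then have fr: "frontier (proj_face \<sigma>) = closure (proj_face \<sigma>) - proj_face \<sigma>"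
    by (simp add: frontier_def interior_open)
  have on_face: "proj_point v \<in> frontier (proj_face \<sigma>) \<longleftrightarrow> conforms \<tau> \<sigma> \<or> conforms \<tau> (- \<sigma>)"
    if v: "v \<in> face \<tau>" for v
  proof -
    have v': "v \<noteq> 0" "signs v = \<tau>" using v t0 by (auto simp: face_def)
    have "\<tau> \<noteq> \<sigma>" "\<tau> \<noteq> - \<sigma>"
      using assms(1) minus_covectors[OF assms(1)] subtope_not_tope[OF assms(2)] by auto
    then have "proj_point v \<notin> proj_face \<sigma>"
      using proj_point_in_proj_face_iff[OF v'(1) tope_zero[OF assms(1)]] v'(2) by simp
    then show ?thesis
      using fr proj_point_in_closure_iff[OF assms v'(2,1)] by simp
  qed
  have "face \<tau> \<noteq> {}"
    using face_nonempty subtopes_subset assms(2) by auto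
  then show ?thesis
    using on_face unfolding proj_face_def[of \<tau>] by auto
qed

lemma minus_subtopes: "\<tau> \<in> subtopes \<Longrightarrow> - \<tau> \<in> subtopes"
  unfolding subtopes_def by (elim UN_E, rule UN_I, assumption, rule minus_covectors)

lemma proj_face_uminus_subtope: "\<tau> \<in> subtopes \<Longrightarrow> proj_face (- \<tau>) = proj_face \<tau>"
proof -
  assume "\<tau> \<in> subtopes"
  then obtain h where h: "\<tau> \<in> covectors {h}" by (rule subtope_cases)
  show ?thesis
    using proj_face_eq_iff[OF h _ _ minus_covectors[OF h]] by simp
qed

text \<open>A facet that bounds the antipodal cell has the same projection as its own antipode, which
  bounds the cell itself.\<close>

lemma proj_sides_eq:
  assumes "\<sigma> \<in> topes"
  shows "sides A (proj_face \<sigma>) = proj_face ` {\<tau> \<in> subtopes. conforms \<tau> \<sigma>}"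
proof (intro equalityI subsetI)
  fix s assume s: "s \<in> sides A (proj_face \<sigma>)"
  then obtain \<tau> where t: "\<tau> \<in> subtopes" "s = proj_face \<tau>" "proj_face \<tau> \<subseteq> frontier (proj_face \<sigma>)"
    unfolding sides_def proj_facets_eq by auto
  then have "conforms \<tau> \<sigma> \<or> conforms \<tau> (- \<sigma>)"
    using proj_face_subset_frontier_iff[OF assms] by simp
  then show "s \<in> proj_face ` {\<tau> \<in> subtopes. conforms \<tau> \<sigma>}"
  proof
    assume "conforms \<tau> (- \<sigma>)"
    then have "conforms (- \<tau>) \<sigma>"
      by (auto simp: conforms_def)
    then show ?thesis
      using minus_subtopes[OF t(1)] proj_face_uminus_subtope[OF t(1)] t(2)
      by (intro image_eqI[of _ _ "- \<tau>"]) auto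
  qed (use t in auto)
next
  fix s assume "s \<in> proj_face ` {\<tau> \<in> subtopes. conforms \<tau> \<sigma>}"
  then show "s \<in> sides A (proj_face \<sigma>)"
    using proj_face_subset_frontier_iff[OF assms] by (auto simp: sides_def proj_facets_eq)
qed

text \<open>Only antipodal facets have the same projection, and they cannot both bound the same cell:
  they have opposite nonzero signs on some plane.\<close>

lemma card_proj_sides:
  assumes "\<sigma> \<in> topes"
  shows "card (sides A (proj_face \<sigma>)) = card (walls \<sigma>)"
proof -
  have "inj_on proj_face {\<tau> \<in> subtopes. conforms \<tau> \<sigma>}"
  proof (rule inj_onI)
    fix \<tau> \<tau>' assume t: "\<tau> \<in> {\<tau> \<in> subtopes. conforms \<tau> \<sigma>}" "\<tau>' \<in> {\<tau> \<in> subtopes. conforms \<tau> \<sigma>}"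
      "proj_face \<tau> = proj_face \<tau>'"
    from t(1) obtain h where h: "\<tau> \<in> covectors {h}" by (auto elim: subtope_cases)
    from t(2) obtain h' where h': "\<tau>' \<in> covectors {h'}" by (auto elim: subtope_cases)
    obtain k where k: "\<tau> k \<noteq> 0"
      using nonzero_covector[OF h] by auto
    have "\<tau>' \<noteq> - \<tau>"
    proof
      assume "\<tau>' = - \<tau>"
      then have "\<sigma> k = - \<tau> k" "\<sigma> k = \<tau> k"
        using t(1,2) k by (auto simp: conforms_def)
      then show False using k by simp
    qed
    then show "\<tau> = \<tau>'"
      using proj_face_eq_iff[OF h _ _ h'] t(3) by simp
  qed
  then show ?thesis
    by (simp add: proj_sides_eq[OF assms] card_image card_conforming_subtopes[OF assms])
qed

lemma finite_proj_cells: "finite (cells A)"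
  unfolding proj_cells_eq using finite_subset[OF topes_subset finite_covectors] by simp

text \<open>Exactly the antipodal pairs of cells have the same projection.\<close>

lemma card_cells_lift_arrangement: "card (cells (lift_arrangement A)) = 2 * card (cells A)"
proof -
  have fin: "finite topes"
    using finite_subset[OF topes_subset finite_covectors] .
  have fibre: "card {\<rho> \<in> topes. proj_face \<rho> = proj_face \<sigma>} = 2" if s: "\<sigma> \<in> topes" for \<sigma>
  proof -
    have "proj_face \<rho> = proj_face \<sigma> \<longleftrightarrow> \<rho> = \<sigma> \<or> \<rho> = - \<sigma>" if "\<rho> \<in> topes" for \<rho>
      using proj_face_eq_iff[OF s _ _ that] by (simp add: eq_commute)
    then have "{\<rho> \<in> topes. proj_face \<rho> = proj_face \<sigma>} = {\<sigma>, - \<sigma>}"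
      using s minus_covectors[OF s] by blast
    moreover obtain h where "\<sigma> h \<noteq> 0"
      using nonzero_covector[OF s] by auto
    then have "\<sigma> \<noteq> - \<sigma>"
      by (auto simp: fun_eq_iff)
    ultimately show ?thesis by simp
  qed
  have "card (cells (lift_arrangement A)) = card topes"
    unfolding cells_eq by (intro card_image inj_on_subset[OF inj_on_face] topes_subset)
  also have "\<dots> = (\<Sum>c\<in>proj_face ` topes. card {\<rho> \<in> topes. proj_face \<rho> = c})"
    using sum.image_gen[OF fin, of "\<lambda>_. 1 :: nat" proj_face] by simp
  also have "\<dots> = (\<Sum>c\<in>proj_face ` topes. 2)"
    using fibre by (intro sum.cong) auto
  also have "\<dots> = 2 * card (cells A)"
    by (simp add: proj_cells_eq)
  finally show ?thesis .
qed

end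

section \<open>The dual graph of a simplicial arrangement\<close>

text \<open>Applied to a simplicial arrangement this provides a triangle, and hence three lines.\<close>

lemma cells_nonempty:
  assumes "line_arrangement A"
  shows "cells A \<noteq> {}"
proof -
  obtain a where a: "\<And>l. l \<in> A \<Longrightarrow> a l \<noteq> 0 \<and> lift_line l = {x. a l \<bullet> x = 0}"
    using assms lift_line_hyperplane unfolding line_arrangement_def by metis
  have "finite (a ` A)" "0 \<notin> a ` A"
    using assms a by (auto simp: line_arrangement_def)
  moreover have "open (- {0 :: real^3})" "- {0 :: real^3} \<noteq> {}"
    by (auto intro!: exI[of _ "axis 1 1"] simp: axis_eq_0_iff)
  ultimately obtain x where "x \<noteq> 0" "\<forall>l\<in>A. a l \<bullet> x \<noteq> 0"
    using exists_generic_point[of "- {0}" "a ` A"] by auto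
  then have "proj_point x \<in> - \<Union>A"
    using a assms by (auto simp: line_arrangement_def proj_point_in_line_iff)
  then show ?thesis
    by (auto simp: cells_def)
qed

theorem theorem1:
  fixes A :: "proj_plane set set"
  assumes "simplicial A"
  shows "cubic (arrangement_graph A) \<and> partial_cube (arrangement_graph A) \<and>
    finite (cells A) \<and> card (pverts (arrangement_graph A)) = 2 * card (cells A)"
proof -
  have arr: "line_arrangement A" and tri: "\<And>c. c \<in> cells A \<Longrightarrow> triangle_in A c"
    using assms by (auto simp: simplicial_def)
  have finA: "finite A" using arr by (simp add: line_arrangement_def)
  obtain c where "c \<in> cells A"
    using cells_nonempty[OF arr] by blast
  then have "card {l \<in> A. \<exists>s\<in>sides A c. s \<subseteq> l} = 3"
    using tri by (simp add: triangle_in_def)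
  then have two: "2 \<le> card A"
    using card_mono[OF finA, of "{l \<in> A. \<exists>s\<in>sides A c. s \<subseteq> l}"] by simp
  define normal where "normal P = (SOME a. a \<noteq> 0 \<and> P = {x. a \<bullet> x = 0})" for P :: "(real^3) set"
  have "normal (lift_line l) \<noteq> 0 \<and> lift_line l = {x. normal (lift_line l) \<bullet> x = 0}" if "l \<in> A" for l
    unfolding normal_def
    by (rule someI_ex) (use lift_line_hyperplane arr that in \<open>simp add: line_arrangement_def\<close>)
  then interpret projective_arrangement A normal
    using arr two by unfold_locales auto
  have "out_degree (with_proj (arrangement_graph A)) v = 3" if v: "v \<in> pverts (arrangement_graph A)" for v
  proof -
    obtain \<sigma> where s: "\<sigma> \<in> topes" "v = face \<sigma>"
      using v by (auto simp: arrangement_graph_def dual_graph_def cells_eq)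
    then have "triangle_in A (proj_face \<sigma>)"
      using tri by (simp add: proj_cells_eq)
    then show ?thesis
      using s card_proj_sides[OF s(1)] out_degree_eq_card_walls[OF s(1)]
      by (simp add: triangle_in_def arrangement_graph_def)
  qed
  then show ?thesis
    using pair_graph_dual_graph partial_cube_dual_graph finite_proj_cells card_cells_lift_arrangement
    by (simp add: cubic_def arrangement_graph_def dual_graph_def)
qed

end
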